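(* (1) For any integers $m,n\ge 2$, every PSD $m\times n$ monic symmetric biquadratic form is a sum of squares of bilinear forms. That is, if $a,b,c\in\mathbb{R}$ are such that $$P(\mathbf{x},\mathbf{y})=\sum_{i=1}^m\sum_{j=1}^n x_i^2y_j^2+a\sum_{i\ne k}\sum_{j=1}^n x_ix_ky_j^2+b\sum_{i=1}^m\sum_{j\ne l}x_i^2y_jy_l+c\sum_{i\ne k}\sum_{j\ne l}x_iy_jx_ky_l$$ is PSD, then $P=\sum_{p=1}^r f_p^2$ for some finite $r$ and real bilinear forms $f_p$ in $(\mathbf{x},\mathbf{y})$. (2) Consequently, every PSD symmetric biquadratic form is SOS.
   Context: An $m\times n$ biquadratic form is a real polynomial $P(\mathbf{x},\mathbf{y})=\sum_{i,k=1}^m\sum_{j,l=1}^n a_{ijkl}x_iy_jx_ky_l$ in $\mathbf{x}\in\mathbb{R}^m$, $\mathbf{y}\in\mathbb{R}^n$ with $a_{ijkl}\in\mathbb{R}$. It is PSD (positive semi-definite) if $P(\mathbf{x},\mathbf{y})\ge0$ for all $\mathbf{x}\in\mathbb{R}^m,\mathbf{y}\in\mathbb{R}^n$. It is SOS if $P=\sum_{p=1}^r f_p^2$ for some finite $r$ and bilinear forms $f_p(\mathbf{x},\mathbf{y})=\sum_{i,j}w^{(p)}_{ij}x_iy_j$ with real coefficients. It is $x$-symmetric if $P(x_1,\dots,x_m,y_1,\dots,y_n)=P(x_{\sigma(1)},\dots,x_{\sigma(m)},y_1,\dots,y_n)$ for every permutation $\sigma$ of $\{1,\dots,m\}$; $y$-symmetric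 is defined analogously with permutations of the $y$-variables; and it is a symmetric biquadratic form if it is both $x$-symmetric and $y$-symmetric. In the displayed formula, sums over $i\ne k$ and $j\ne l$ run over all ordered pairs of distinct indices in $\{1,\dots,m\}$ and $\{1,\dots,n\}$ respectively. A form of the displayed shape is called a monic symmetric biquadratic form. *)

theory Defs
  imports "HOL-Analysis.Analysis" "HOL-Combinatorics.Permutations"
begin

text \<open>Forms are represented by the real functions they define; over the infinite field of reals,
  identities of such functions are the same as identities of polynomials.\<close>

definition biquadratic_form :: "(real^'m \<Rightarrow> real^'n \<Rightarrow> real) \<Rightarrow> bool" where
  "biquadratic_form P \<longleftrightarrow>
    (\<exists>a :: 'm \<Rightarrow> 'n \<Rightarrow> 'm \<Rightarrow> 'n \<Rightarrow> real. \<forall>x y.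
      P x y = (\<Sum>i\<in>UNIV. \<Sum>k\<in>UNIV. \<Sum>j\<in>UNIV. \<Sum>l\<in>UNIV. a i j k l * x $ i * y $ j * x $ k * y $ l))"

definition psd :: "(real^'m \<Rightarrow> real^'n \<Rightarrow> real) \<Rightarrow> bool" where
  "psd P \<longleftrightarrow> (\<forall>x y. P x y \<ge> 0)"

definition bilinear_form :: "('m \<Rightarrow> 'n \<Rightarrow> real) \<Rightarrow> real^'m \<Rightarrow> real^'n \<Rightarrow> real" where
  "bilinear_form w x y = (\<Sum>i\<in>UNIV. \<Sum>j\<in>UNIV. w i j * x $ i * y $ j)"

definition sos :: "(real^'m \<Rightarrow> real^'n \<Rightarrow> real) \<Rightarrow> bool" where
  "sos P \<longleftrightarrow>
    (\<exists>(r::nat) (w :: nat \<Rightarrow> 'm \<Rightarrow> 'n \<Rightarrow> real). \<forall>x y.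
      P x y = (\<Sum>p<r. (bilinear_form (w p) x y)\<^sup>2))"

definition x_symmetric :: "(real^'m \<Rightarrow> real^'n \<Rightarrow> real) \<Rightarrow> bool" where
  "x_symmetric P \<longleftrightarrow> (\<forall>\<sigma>. \<sigma> permutes UNIV \<longrightarrow> (\<forall>x y. P (\<chi> i. x $ \<sigma> i) y = P x y))"

definition y_symmetric :: "(real^'m \<Rightarrow> real^'n \<Rightarrow> real) \<Rightarrow> bool" where
  "y_symmetric P \<longleftrightarrow> (\<forall>\<sigma>. \<sigma> permutes UNIV \<longrightarrow> (\<forall>x y. P x (\<chi> j. y $ \<sigma> j) = P x y))"

definition symmetric_biquadratic_form :: "(real^'m \<Rightarrow> real^'n \<Rightarrow> real) \<Rightarrow> bool" where
  "symmetric_biquadratic_form P \<longleftrightarrow> biquadratic_form P \<and> x_symmetric P \<and> y_symmetric P"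

definition monic_symmetric_form :: "real \<Rightarrow> real \<Rightarrow> real \<Rightarrow> real^'m \<Rightarrow> real^'n \<Rightarrow> real" where
  "monic_symmetric_form a b c x y =
      (\<Sum>i\<in>UNIV. \<Sum>j\<in>UNIV. (x $ i)\<^sup>2 * (y $ j)\<^sup>2)
    + a * (\<Sum>i\<in>UNIV. \<Sum>k\<in>UNIV - {i}. \<Sum>j\<in>UNIV. x $ i * x $ k * (y $ j)\<^sup>2)
    + b * (\<Sum>i\<in>UNIV. \<Sum>j\<in>UNIV. \<Sum>l\<in>UNIV - {j}. (x $ i)\<^sup>2 * y $ j * y $ l)
    + c * (\<Sum>i\<in>UNIV. \<Sum>k\<in>UNIV - {i}. \<Sum>j\<in>UNIV. \<Sum>l\<in>UNIV - {j}. x $ i * y $ j * x $ k * y $ l)"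

end

theory Submission imports Defs begin

text \<open>
  Fix \<open>y\<close> and regard a symmetric biquadratic form as a quadratic form in \<open>x \<in> \<real>\<^sup>m\<close> invariant
  under all coordinate permutations. Such forms are spanned by \<open>(\<Sum>\<^sub>i x\<^sub>i)\<^sup>2\<close> and
  \<open>\<Sum>\<^sub>i\<^sub>k (x\<^sub>i - x\<^sub>k)\<^sup>2\<close>: the permutation representation \<open>\<real>\<^sup>m\<close> is the sum of the constant vectors
  and the vectors of coordinate sum zero, and these are the squared norms, up to a factor, of the
  two components. The first form vanishes at a difference \<open>d\<close> of two unit vectors, the second one
  at the all-ones vector, so the two coefficients are positive multiples of the values of the
  quadratic form at the all-ones vector and at \<open>d\<close> (\<open>invariant_quadratic_form\<close>).

  Applying this in \<open>x\<close> and then in \<open>y\<close> writes the biquadratic form as a combination of the four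
  products of such squares in \<open>x\<close> and in \<open>y\<close>, with coefficients that are positive multiples of
  its values at four points. If the form is PSD, these are nonnegative. Each product is a sum of
  squares of products of a linear form in \<open>x\<close> and a linear form in \<open>y\<close>, hence of bilinear forms.
  This settles all symmetric biquadratic forms, and the monic ones are among them
  (\<open>monic_symmetric_form_symmetric\<close>).
\<close>

section \<open>Closure properties of sums of squares of bilinear forms\<close>

lemma sos_add:
  assumes "sos P" "sos Q"
  shows "sos (\<lambda>x y. P x y + Q x y)"
proof -
  obtain r :: nat and w where P: "P x y = (\<Sum>p<r. (bilinear_form (w p) x y)\<^sup>2)" for x y
    using assms(1) unfolding sos_def by blast
  obtain s :: nat and v where Q: "Q x y = (\<Sum>p<s. (bilinear_form (v p) x y)\<^sup>2)" for x y
    using assms(2) unfolding sos_def by blast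
  define u where "u p = (if p < r then w p else v (p - r))" for p
  have "(\<Sum>p<r + t. (bilinear_form (u p) x y)\<^sup>2)
      = P x y + (\<Sum>p<t. (bilinear_form (v p) x y)\<^sup>2)" for t x y
    by (induction t) (simp_all add: P u_def)
  then have "P x y + Q x y = (\<Sum>p<r + s. (bilinear_form (u p) x y)\<^sup>2)" for x y
    by (simp add: Q)
  then show ?thesis unfolding sos_def by blast
qed

lemma bilinear_form_scale: "bilinear_form (\<lambda>i j. c * w i j) x y = c * bilinear_form w x y"
  by (simp add: bilinear_form_def sum_distrib_left mult.assoc)

lemma sos_scale:
  assumes "sos P" "c \<ge> 0"
  shows "sos (\<lambda>x y. c * P x y)"
proof -
  obtain r :: nat and w where P: "P x y = (\<Sum>p<r. (bilinear_form (w p) x y)\<^sup>2)" for x y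
    using assms(1) unfolding sos_def by blast
  have "c * P x y = (\<Sum>p<r. (bilinear_form (\<lambda>i j. sqrt c * w p i j) x y)\<^sup>2)" for x y
    using \<open>c \<ge> 0\<close> by (simp add: P bilinear_form_scale power_mult_distrib sum_distrib_left)
  then show ?thesis unfolding sos_def by (intro exI[of _ r] exI[of _ "\<lambda>p i j. sqrt c * w p i j"]) blast
qed

lemma sos_sum:
  assumes "finite I" "\<And>p. p \<in> I \<Longrightarrow> sos (F p)"
  shows "sos (\<lambda>x y. \<Sum>p\<in>I. F p x y)"
  using assms
proof (induction I rule: finite_induct)
  case empty
  show ?case unfolding sos_def by (intro exI[of _ "0::nat"]) simp
next
  case (insert p I)
  then show ?case by (simp add: sos_add)
qed

lemma sos_product_of_linear_squares:
  fixes f :: "real^'m" and g :: "real^'n"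
  shows "sos (\<lambda>x y. (f \<bullet> x)\<^sup>2 * (g \<bullet> y)\<^sup>2)"
proof -
  have "(f \<bullet> x)\<^sup>2 * (g \<bullet> y)\<^sup>2 = (bilinear_form (\<lambda>i j. f $ i * g $ j) x y)\<^sup>2" for x y
    by (simp add: bilinear_form_def inner_vec_def sum_product mult_ac flip: power_mult_distrib)
  then show ?thesis
    unfolding sos_def by (intro exI[of _ "1::nat"] exI[of _ "\<lambda>_ i j. f $ i * g $ j"]) simp
qed

lemma sos_product:
  fixes f :: "'p \<Rightarrow> real^'m" and g :: "'q \<Rightarrow> real^'n"
  assumes "finite I" "finite J"
  shows "sos (\<lambda>x y. (\<Sum>p\<in>I. (f p \<bullet> x)\<^sup>2) * (\<Sum>q\<in>J. (g q \<bullet> y)\<^sup>2))"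
  unfolding sum_product
  by (intro sos_sum assms sos_product_of_linear_squares)

section \<open>Quadratic forms invariant under coordinate permutations\<close>

definition total :: "real^'m \<Rightarrow> real" where
  "total x = (\<Sum>i\<in>UNIV. x $ i)"

definition spread :: "real^'m \<Rightarrow> real" where
  "spread x = (\<Sum>i\<in>UNIV. \<Sum>k\<in>UNIV. (x $ i - x $ k)\<^sup>2)"

lemma total_sq_as_linear_squares:
  "(total x)\<^sup>2 = (\<Sum>p\<in>{()}. (1 \<bullet> x)\<^sup>2)"
  by (simp add: total_def inner_vec_def)

lemma spread_as_linear_squares:
  "spread x = (\<Sum>(i, k)\<in>UNIV. ((axis i 1 - axis k 1) \<bullet> x)\<^sup>2)"
  by (simp add: spread_def inner_diff_left inner_axis' sum.cartesian_product
      flip: UNIV_Times_UNIV)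

lemma spread_eq:
  fixes x :: "real^'m"
  shows "spread x = 2 * real CARD('m) * (\<Sum>i\<in>UNIV. (x $ i)\<^sup>2) - 2 * (total x)\<^sup>2"
proof -
  have "spread x = (\<Sum>i\<in>UNIV. \<Sum>k\<in>UNIV. (x $ i)\<^sup>2 + (x $ k)\<^sup>2 - 2 * (x $ i * x $ k))"
    by (simp add: spread_def power2_diff mult.assoc)
  also have "\<dots> = 2 * real CARD('m) * (\<Sum>i\<in>UNIV. (x $ i)\<^sup>2)
                   - 2 * (\<Sum>i\<in>UNIV. \<Sum>k\<in>UNIV. x $ i * x $ k)"
    by (simp add: sum.distrib sum_subtractf flip: sum_distrib_left)
  finally show ?thesis
    by (simp add: total_def power2_eq_square sum_product)
qed

lemma permutation_moving_pair:
  assumes "i \<noteq> k" "i' \<noteq> k'"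
  obtains \<sigma> where "\<sigma> permutes UNIV" "\<sigma> i' = i" "\<sigma> k' = k"
proof
  let ?\<tau> = "Transposition.transpose i' i"
  let ?\<sigma> = "Transposition.transpose (?\<tau> k') k \<circ> ?\<tau>"
  show "?\<sigma> permutes UNIV"
    by (intro permutes_compose permutes_swap_id) auto
  \<comment> \<open>the second transposition fixes \<open>i\<close>, because \<open>k \<noteq> i\<close> and \<open>\<tau> k' \<noteq> \<tau> i' = i\<close>\<close>
  show "?\<sigma> i' = i" "?\<sigma> k' = k"
    using assms by (auto simp: Transposition.transpose_def)
qed

text \<open>
  The coefficients are evaluations of \<open>Q\<close>, hence linear in \<open>Q\<close> and nonnegative for nonnegative
  \<open>Q\<close>; linearity makes it possible to apply the result in each group of variables in
  turn. In dimension one \<open>i0\<close> and \<open>k0\<close> are necessarily equal, and the spread is identically zero.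
\<close>

lemma invariant_quadratic_form:
  fixes Q :: "real^'m \<Rightarrow> real"
  assumes Q: "\<And>x. Q x = (\<Sum>i\<in>UNIV. \<Sum>k\<in>UNIV. q i k * x $ i * x $ k)"
    and inv: "\<And>\<sigma> x. \<sigma> permutes UNIV \<Longrightarrow> Q (\<chi> i. x $ \<sigma> i) = Q x"
    and distinct: "i0 \<noteq> k0 \<or> CARD('m) = 1"
  shows "Q x = Q 1 / (real CARD('m))\<^sup>2 * (total x)\<^sup>2
             + Q (axis i0 1 - axis k0 1) / (4 * real CARD('m)) * spread x"
proof -
  let ?m = "real CARD('m)"
  have Q_axis: "Q (axis i 1) = q i i" for i
    by (simp add: Q axis_def if_distrib[of "\<lambda>z. _ * z"] cong: if_cong)
  have Q_axis2: "Q (axis i 1 + axis k 1) = q i i + q i k + q k i + q k k" for i k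
    by (simp add: Q axis_def distrib_left distrib_right sum.distrib
        if_distrib[of "\<lambda>z. _ * z"] cong: if_cong)
  have invaxis: "(\<chi> j. axis (\<sigma> i) 1 $ \<sigma> j) = (axis i 1 :: real^'m)" if "\<sigma> permutes UNIV" for \<sigma> i
    using permutes_inj[OF that] by (auto simp: vec_eq_iff axis_def inj_eq)
  \<comment> \<open>invariance is tested on unit vectors and on sums of two of them: all diagonal coefficients
    agree, and so do all symmetrised off-diagonal ones\<close>
  have diag: "q i i = q i0 i0" for i
  proof -
    have "Q (axis i 1) = Q (axis i0 1)"
      using inv[of "Transposition.transpose i i0" "axis i0 1"] invaxis[of "Transposition.transpose i i0" i]
      by (simp add: permutes_swap_id)
    then show ?thesis by (simp add: Q_axis)
  qed
  have off: "q i k + q k i = q i' k' + q k' i'" if ne: "i \<noteq> k" "i' \<noteq> k'" for i k i' k'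
  proof -
    obtain \<sigma> where \<sigma>: "\<sigma> permutes UNIV" "\<sigma> i' = i" "\<sigma> k' = k"
      by (rule permutation_moving_pair[OF ne])
    have "(\<chi> j. (axis i 1 + axis k 1) $ \<sigma> j) = (axis i' 1 + axis k' 1 :: real^'m)"
      using invaxis[OF \<sigma>(1), of i'] invaxis[OF \<sigma>(1), of k'] \<sigma>(2,3)
      by (simp add: vec_eq_iff)
    then have "Q (axis i' 1 + axis k' 1) = Q (axis i 1 + axis k 1)"
      using inv[OF \<sigma>(1), of "axis i 1 + axis k 1"] by simp
    then show ?thesis
      using diag[of i] diag[of k] diag[of i'] diag[of k'] by (simp add: Q_axis2)
  qed
  define D where "D = q i0 i0"
  define E where "E = q i0 k0 + q k0 i0"
  \<comment> \<open>in dimension one \<open>i0 = k0\<close>, so that \<open>E = 2 * D\<close> and the formula below still holds\<close>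
  have coeff: "q i k + q k i = (if i = k then 2 * D else E)" for i k
  proof (cases "i = k")
    case True
    then show ?thesis using diag[of i] by (simp add: D_def)
  next
    case False
    then have "CARD('m) \<noteq> 1"
      by (metis UNIV_I card_1_singletonE singletonD)
    then show ?thesis using off[OF False] distinct False by (simp add: E_def)
  qed
  have form: "2 * Q z = E * (total z)\<^sup>2 + (2 * D - E) * (\<Sum>i\<in>UNIV. (z $ i)\<^sup>2)" for z
  proof -
    have "2 * Q z = (\<Sum>i\<in>UNIV. \<Sum>k\<in>UNIV. q i k * z $ i * z $ k)
                  + (\<Sum>i\<in>UNIV. \<Sum>k\<in>UNIV. q k i * z $ k * z $ i)"
      using sum.swap[of "\<lambda>i k. q i k * z $ i * z $ k" UNIV UNIV] by (simp add: Q)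
    also have "\<dots> = (\<Sum>i\<in>UNIV. \<Sum>k\<in>UNIV. (q i k + q k i) * (z $ i * z $ k))"
      by (simp add: sum.distrib algebra_simps)
    also have "\<dots> = (\<Sum>i\<in>UNIV. \<Sum>k\<in>UNIV. E * (z $ i * z $ k)
                      + (if i = k then (2 * D - E) * (z $ i)\<^sup>2 else 0))"
      by (intro sum.cong refl) (auto simp: coeff power2_eq_square algebra_simps)
    also have "\<dots> = E * (\<Sum>i\<in>UNIV. \<Sum>k\<in>UNIV. z $ i * z $ k)
                   + (2 * D - E) * (\<Sum>i\<in>UNIV. (z $ i)\<^sup>2)"
      by (simp add: sum.distrib sum_distrib_left)
    finally show ?thesis
      by (simp add: total_def power2_eq_square sum_product)
  qed
  have one: "2 * Q 1 = E * ?m\<^sup>2 + (2 * D - E) * ?m"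
    using form[of 1] by (simp add: total_def)
  have diff: "Q (axis i0 1 - axis k0 1) = 2 * D - E"
  proof -
    have "Q (axis i0 1 - axis k0 1) = q i0 i0 - q i0 k0 - q k0 i0 + q k0 k0"
      by (simp add: Q axis_def left_diff_distrib right_diff_distrib sum_subtractf
          if_distrib[of "\<lambda>z. _ * z"] cong: if_cong)
    then show ?thesis using diag[of k0] by (simp add: D_def E_def)
  qed
  have "?m > 0" by simp
  have "2 * Q x = 2 * (Q 1 / ?m\<^sup>2 * (total x)\<^sup>2 + (2 * D - E) / (4 * ?m) * spread x)"
  proof -
    have "2 * (Q 1 / ?m\<^sup>2 * (total x)\<^sup>2 + (2 * D - E) / (4 * ?m) * spread x)
        = (2 * Q 1) / ?m\<^sup>2 * (total x)\<^sup>2 + (2 * D - E) / (2 * ?m) * spread x"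
      by (simp add: field_simps)
    also have "\<dots> = E * (total x)\<^sup>2 + (2 * D - E) * (\<Sum>i\<in>UNIV. (x $ i)\<^sup>2)"
      unfolding one spread_eq using \<open>?m > 0\<close>
      by (simp add: field_simps power2_eq_square)
    finally show ?thesis by (simp add: form)
  qed
  then show ?thesis unfolding diff by (rule mult_left_cancel[THEN iffD1, rotated]) simp
qed

section \<open>Symmetric biquadratic forms\<close>

lemma sum_pairs:
  fixes g :: "'a::finite \<Rightarrow> 'b::finite \<Rightarrow> real"
  shows "(\<Sum>i\<in>UNIV. \<Sum>k\<in>UNIV. g i k) = (\<Sum>p\<in>UNIV. g (fst p) (snd p))"
  by (simp add: sum.cartesian_product case_prod_unfold)

lemma sum_swap_pairs:
  fixes f :: "'a::finite \<Rightarrow> 'b::finite \<Rightarrow> 'c::finite \<Rightarrow> 'd::finite \<Rightarrow> real"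
  shows "(\<Sum>i\<in>UNIV. \<Sum>k\<in>UNIV. \<Sum>j\<in>UNIV. \<Sum>l\<in>UNIV. f i k j l)
       = (\<Sum>j\<in>UNIV. \<Sum>l\<in>UNIV. \<Sum>i\<in>UNIV. \<Sum>k\<in>UNIV. f i k j l)"
proof -
  have "(\<Sum>i\<in>UNIV. \<Sum>k\<in>UNIV. \<Sum>j\<in>UNIV. \<Sum>l\<in>UNIV. f i k j l)
      = (\<Sum>p\<in>UNIV. \<Sum>q\<in>UNIV. f (fst p) (snd p) (fst q) (snd q))"
    by (rule trans[OF sum_pairs sum.cong[OF refl sum_pairs]])
  also have "\<dots> = (\<Sum>q\<in>UNIV. \<Sum>p\<in>UNIV. f (fst p) (snd p) (fst q) (snd q))"
    by (rule sum.swap)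
  also have "\<dots> = (\<Sum>j\<in>UNIV. \<Sum>l\<in>UNIV. \<Sum>i\<in>UNIV. \<Sum>k\<in>UNIV. f i k j l)"
    by (rule sym, rule trans[OF sum_pairs sum.cong[OF refl sum_pairs]])
  finally show ?thesis .
qed

theorem psd_symmetric_biquadratic_form_sos:
  fixes P :: "real^'m \<Rightarrow> real^'n \<Rightarrow> real"
  assumes sym: "symmetric_biquadratic_form P" and psd: "psd P"
  shows "sos P"
proof -
  obtain a where a: "P x y =
      (\<Sum>i\<in>UNIV. \<Sum>k\<in>UNIV. \<Sum>j\<in>UNIV. \<Sum>l\<in>UNIV. a i j k l * x $ i * y $ j * x $ k * y $ l)" for x y
    using sym unfolding symmetric_biquadratic_form_def biquadratic_form_def by blast
  have xsym: "P (\<chi> i. x $ \<sigma> i) y = P x y" if "\<sigma> permutes UNIV" for \<sigma> x y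
    using sym that unfolding symmetric_biquadratic_form_def x_symmetric_def by blast
  have ysym: "P x (\<chi> j. y $ \<sigma> j) = P x y" if "\<sigma> permutes UNIV" for \<sigma> x y
    using sym that unfolding symmetric_biquadratic_form_def y_symmetric_def by blast
  have pos: "P x y \<ge> 0" for x y using psd by (simp add: psd_def)
  obtain i0 k0 :: 'm where ik: "i0 \<noteq> k0 \<or> CARD('m) = 1"
    by (metis (full_types) UNIV_eq_I card_1_singleton_iff insertCI One_nat_def)
  obtain j0 l0 :: 'n where jl: "j0 \<noteq> l0 \<or> CARD('n) = 1"
    by (metis (full_types) UNIV_eq_I card_1_singleton_iff insertCI One_nat_def)
  define d :: "real^'m" where "d = axis i0 1 - axis k0 1"
  define e :: "real^'n" where "e = axis j0 1 - axis l0 1"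
  let ?m = "real CARD('m)" and ?n = "real CARD('n)"
  have in_x: "P x y = P 1 y / ?m\<^sup>2 * (total x)\<^sup>2 + P d y / (4 * ?m) * spread x" for x y
    unfolding d_def
  proof (rule invariant_quadratic_form[OF _ _ ik,
        where q = "\<lambda>i k. \<Sum>j\<in>UNIV. \<Sum>l\<in>UNIV. a i j k l * y $ j * y $ l"])
    show "P x y = (\<Sum>i\<in>UNIV. \<Sum>k\<in>UNIV.
        (\<Sum>j\<in>UNIV. \<Sum>l\<in>UNIV. a i j k l * y $ j * y $ l) * x $ i * x $ k)" for x
      unfolding a sum_distrib_right by (intro sum.cong refl) (simp add: mult_ac)
  qed (rule xsym)
  have in_y: "P x y = P x 1 / ?n\<^sup>2 * (total y)\<^sup>2 + P x e / (4 * ?n) * spread y" for x y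
    unfolding e_def
  proof (rule invariant_quadratic_form[OF _ _ jl,
        where q = "\<lambda>j l. \<Sum>i\<in>UNIV. \<Sum>k\<in>UNIV. a i j k l * x $ i * x $ k"])
    show "P x y = (\<Sum>j\<in>UNIV. \<Sum>l\<in>UNIV.
        (\<Sum>i\<in>UNIV. \<Sum>k\<in>UNIV. a i j k l * x $ i * x $ k) * y $ j * y $ l)" for y
      unfolding a sum_distrib_right
      by (subst sum_swap_pairs) (simp add: mult_ac)
  qed (rule ysym)
  \<comment> \<open>expanding \<open>P 1 y\<close> and \<open>P d y\<close> in the first decomposition by the second one\<close>
  define A where "A = P 1 1 / (?m\<^sup>2 * ?n\<^sup>2)"
  define B where "B = P 1 e / (?m\<^sup>2 * (4 * ?n))"
  define C where "C = P d 1 / (4 * ?m * ?n\<^sup>2)"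
  define D where "D = P d e / (4 * ?m * (4 * ?n))"
  have nonneg: "A \<ge> 0" "B \<ge> 0" "C \<ge> 0" "D \<ge> 0"
    unfolding A_def B_def C_def D_def using pos by simp_all
  have P: "P x y = A * ((total x)\<^sup>2 * (total y)\<^sup>2) + B * ((total x)\<^sup>2 * spread y)
      + C * (spread x * (total y)\<^sup>2) + D * (spread x * spread y)" for x y
    unfolding in_x[of x y] in_y[of 1 y] in_y[of d y] A_def B_def C_def D_def
    by (simp add: field_simps)
  have "sos (\<lambda>x y. A * ((total (x :: real^'m))\<^sup>2 * (total (y :: real^'n))\<^sup>2)
      + B * ((total x)\<^sup>2 * spread y) + C * (spread x * (total y)\<^sup>2) + D * (spread x * spread y))"
    unfolding total_sq_as_linear_squares spread_as_linear_squares case_prod_unfold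
    by (intro sos_add sos_scale nonneg sos_product) simp_all
  then show ?thesis by (simp flip: P)
qed

lemma sum_offdiagonal:
  fixes f :: "'m::finite \<Rightarrow> 'm \<Rightarrow> real"
  shows "(\<Sum>i\<in>UNIV. \<Sum>k\<in>UNIV. f i k) = (\<Sum>i\<in>UNIV. f i i) + (\<Sum>i\<in>UNIV. \<Sum>k\<in>UNIV - {i}. f i k)"
proof -
  have "(\<Sum>k\<in>UNIV. f i k) = f i i + (\<Sum>k\<in>UNIV - {i}. f i k)" for i
    by (simp add: sum.remove)
  then show ?thesis by (simp add: sum.distrib)
qed

lemma sum_offdiagonal_products:
  fixes x :: "real^'m"
  shows "(\<Sum>i\<in>UNIV. \<Sum>k\<in>UNIV - {i}. x $ i * x $ k) = (total x)\<^sup>2 - (\<Sum>i\<in>UNIV. (x $ i)\<^sup>2)"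
  using sum_offdiagonal[of "\<lambda>i k. x $ i * x $ k"]
  by (simp add: total_def power2_eq_square sum_product)

text \<open>
  Only the sums and the sums of squares of the coordinates occur on the right, which makes the invariance under
  permutations visible.
\<close>

lemma monic_symmetric_form_eq:
  fixes x :: "real^'m" and y :: "real^'n"
  defines "X \<equiv> \<Sum>i\<in>UNIV. (x $ i)\<^sup>2" and "Y \<equiv> \<Sum>j\<in>UNIV. (y $ j)\<^sup>2"
  shows "monic_symmetric_form a b c x y = X * Y + a * (((total x)\<^sup>2 - X) * Y)
      + b * (X * ((total y)\<^sup>2 - Y)) + c * (((total x)\<^sup>2 - X) * ((total y)\<^sup>2 - Y))"
  unfolding monic_symmetric_form_def X_def Y_def sum_offdiagonal_products[symmetric]
  unfolding sum_distrib_right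
  by (simp add: sum_distrib_left mult_ac)

lemma sum_permuted_coordinates:
  fixes f :: "real \<Rightarrow> real" and z :: "real^'k"
  assumes "\<sigma> permutes UNIV"
  shows "(\<Sum>i\<in>UNIV. f (z $ \<sigma> i)) = (\<Sum>i\<in>UNIV. f (z $ i))"
  using sum.permute[OF assms, of "\<lambda>i. f (z $ i)"] by (simp add: o_def)

lemma monic_symmetric_form_symmetric:
  "symmetric_biquadratic_form (monic_symmetric_form a b c :: real^'m \<Rightarrow> real^'n \<Rightarrow> real)"
  unfolding symmetric_biquadratic_form_def
proof (intro conjI)
  define w :: "'m \<Rightarrow> 'n \<Rightarrow> 'm \<Rightarrow> 'n \<Rightarrow> real" where
    "w i j k l = (if i = k then if j = l then 1 else b else if j = l then a else c)" for i j k l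
  have "monic_symmetric_form a b c x y =
      (\<Sum>i\<in>UNIV. \<Sum>k\<in>UNIV. \<Sum>j\<in>UNIV. \<Sum>l\<in>UNIV. w i j k l * x $ i * y $ j * x $ k * y $ l)"
    for x :: "real^'m" and y :: "real^'n"
    unfolding sum_offdiagonal sum.distrib monic_symmetric_form_def
    by (simp add: w_def sum_distrib_left power2_eq_square mult_ac)
  then show "biquadratic_form (monic_symmetric_form a b c :: real^'m \<Rightarrow> real^'n \<Rightarrow> real)"
    unfolding biquadratic_form_def by blast
next
  show "x_symmetric (monic_symmetric_form a b c :: real^'m \<Rightarrow> real^'n \<Rightarrow> real)"
    by (simp add: x_symmetric_def monic_symmetric_form_eq total_def
        sum_permuted_coordinates[where f = "\<lambda>t. t"]
        sum_permuted_coordinates[where f = "\<lambda>t. t\<^sup>2"])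
  show "y_symmetric (monic_symmetric_form a b c :: real^'m \<Rightarrow> real^'n \<Rightarrow> real)"
    by (simp add: y_symmetric_def monic_symmetric_form_eq total_def
        sum_permuted_coordinates[where f = "\<lambda>t. t"]
        sum_permuted_coordinates[where f = "\<lambda>t. t\<^sup>2"])
qed

theorem theorem4p5:
  shows "(CARD('m::finite) \<ge> 2 \<and> CARD('n::finite) \<ge> 2 \<longrightarrow>
            (\<forall>a b c :: real. psd (monic_symmetric_form a b c :: real^'m \<Rightarrow> real^'n \<Rightarrow> real) \<longrightarrow>
                sos (monic_symmetric_form a b c :: real^'m \<Rightarrow> real^'n \<Rightarrow> real)))
       \<and> (\<forall>P :: real^'m \<Rightarrow> real^'n \<Rightarrow> real. symmetric_biquadratic_form P \<longrightarrow> psd P \<longrightarrow> sos P)"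
  using psd_symmetric_biquadratic_form_sos monic_symmetric_form_symmetric by blast

end
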